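(* For an integer $m\ge 3$ and $0<s<1$ let $E=E_{m,s}=\bigcup_{k=1}^m [0,s e^{i2\pi k/m}]\subset\mathbb{B}^2$ and let $c(m,s)=\mathrm{cap}(\mathbb{B}^2,E_{m,s})$. Let $d(m,s)=\mathrm{cap}(\mathbb{B}^2,[0,r])$, where $[0,r]$, $0<r<1$, is the segment whose hyperbolic perimeter is equal to the hyperbolic perimeter of $E_{m,s}$. Then there are numbers $m\geq 3$ (an integer) and $s\in(0,1)$ such that $$d(m,s)\ge c(m,s).$$
   Context: $\mathbb{B}^2=\{z\in\mathbb{C}:|z|<1\}$ is the unit disk, and $[x,y]$ is the Euclidean segment between $x$ and $y$. For a domain $G\subset\mathbb{R}^2$ and a compact non-empty set $E\subset G$, the conformal capacity of the condenser $(G,E)$ is $\mathrm{cap}(G,E)=\inf_u\int_G|\nabla u|^2\,dm$, where the infimum is over all $C_0^\infty(G)$ functions $u:G\to[0,\infty)$ with $u(x)\ge1$ for all $x\in E$, and $dm$ is two-dimensional Lebesgue measure. The hyperbolic metric $\rho_{\mathbb{B}^2}$ of $\mathbb{B}^2$ is given by $\sinh^2\frac{\rho_{\mathbb{B}^2}(x,y)}{2}=\frac{|x-y|^2}{(1-|x|^2)(1-|y|^2)}$ (equivalently, it has density $2|dz|/(1-|z|^2)$). The hyperbolic perimeter of a segment, or of a finite union of segments having only endpoints in common, is twice its total hyperbolic length (each segment is counted with both sides). Thus the hyperbolic perimeter of $[0,r]$ is $4\,\mathrm{artanh}\,r=2\log\frac{1+r}{1-r}$, and the hyperbolic perimeter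 of $E_{m,s}$ is $2m\log\frac{1+s}{1-s}$. *)

theory Defs
  imports "HOL-Analysis.Analysis"
begin

section \<open>Conformal capacity of a planar condenser\<close>

primrec Ck_on :: "nat \<Rightarrow> ('a::real_normed_vector \<Rightarrow> real) \<Rightarrow> 'a set \<Rightarrow> bool" where
  "Ck_on 0 f S \<longleftrightarrow> continuous_on S f"
| "Ck_on (Suc k) f S \<longleftrightarrow> (\<forall>x\<in>S. f differentiable (at x)) \<and>
     (\<forall>v. Ck_on k (\<lambda>x. frechet_derivative f (at x) v) S)"

text \<open>Membership in \<open>C\<^sub>0\<^sup>\<infinity>(G)\<close>, for open \<open>G\<close>. Only the values of \<open>u\<close> on \<open>G\<close> matter, so that a
  total function stands for its restriction to \<open>G\<close>.\<close>

definition smooth_compact_support_on :: "'a::real_normed_vector set \<Rightarrow> ('a \<Rightarrow> real) \<Rightarrow> bool" where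
  "smooth_compact_support_on G u \<longleftrightarrow>
     (\<forall>k. Ck_on k u G) \<and> (\<exists>K. compact K \<and> K \<subseteq> G \<and> (\<forall>x\<in>G - K. u x = 0))"

definition gradient :: "('a::euclidean_space \<Rightarrow> real) \<Rightarrow> 'a \<Rightarrow> 'a" where
  "gradient u x = (\<Sum>b\<in>Basis. frechet_derivative u (at x) b *\<^sub>R b)"

text \<open>The plane is identified with \<open>\<complex>\<close>. The Dirichlet integrals are taken in \<open>[0, \<infinity>]\<close>.\<close>

definition capacity :: "complex set \<Rightarrow> complex set \<Rightarrow> ennreal" where
  "capacity G E =
     (INF u \<in> {u. smooth_compact_support_on G u \<and> (\<forall>z\<in>G. 0 \<le> u z) \<and> (\<forall>z\<in>E. 1 \<le> u z)}.
        \<integral>\<^sup>+z\<in>G. ennreal ((norm (gradient u z))\<^sup>2) \<partial>lborel)"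


section \<open>Hyperbolic perimeter\<close>

text \<open>Length of the segment from \<open>a\<close> to \<open>b\<close> in the unit disk for the density
  \<open>2|dz| / (1 - |z|\<^sup>2)\<close>.\<close>

definition hyperbolic_length :: "complex \<Rightarrow> complex \<Rightarrow> real" where
  "hyperbolic_length a b =
     integral {0..1} (\<lambda>t. 2 * norm (b - a) / (1 - (norm (linepath a b t))\<^sup>2))"

text \<open>\<open>A\<close> is the union of finitely many nondegenerate segments in the unit disk, given by their pairs of
  endpoints, any two of which have at most endpoints (of both) in common.\<close>

definition segment_decomposition :: "(complex \<times> complex) set \<Rightarrow> complex set \<Rightarrow> bool" where
  "segment_decomposition S A \<longleftrightarrow> finite S \<and>
     (\<forall>(a, b)\<in>S. norm a < 1 \<and> norm b < 1 \<and> a \<noteq> b) \<and>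
     (\<forall>(a, b)\<in>S. \<forall>(c, d)\<in>S. (a, b) \<noteq> (c, d) \<longrightarrow>
        closed_segment a b \<inter> closed_segment c d \<subseteq> {a, b} \<inter> {c, d}) \<and>
     A = (\<Union>(a, b)\<in>S. closed_segment a b)"

text \<open>Each segment is counted with both sides. The value does not depend on the decomposition, see
  \<open>hyperbolic_perimeter_eq\<close> below.\<close>

definition hyperbolic_perimeter :: "complex set \<Rightarrow> real" where
  "hyperbolic_perimeter A =
     (THE P. \<exists>S. segment_decomposition S A \<and> P = 2 * (\<Sum>(a, b)\<in>S. hyperbolic_length a b))"

definition star :: "nat \<Rightarrow> real \<Rightarrow> complex set" where
  "star m s = (\<Union>k\<in>{1..m}. closed_segment 0 (of_real s * cis (2 * pi * real k / real m)))"


section \<open>The hyperbolic perimeter is well defined\<close>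

lemma norm_linepath_less_1:
  assumes "norm a < 1" "norm b < 1" "t \<in> {0..1}"
  shows "norm (linepath a b t :: complex) < 1"
proof -
  have "linepath a b t \<in> closed_segment a b"
    using assms(3) linepath_image_01 by blast
  also have "closed_segment a b \<subseteq> ball 0 1"
    using assms by (intro closed_segment_subset) auto
  finally show ?thesis by simp
qed

lemma hyperbolic_density_continuous:
  assumes "norm a < 1" "norm b < 1"
  shows "continuous_on {0..1} (\<lambda>t. 2 * norm (b - a) / (1 - (norm (linepath a b t :: complex))\<^sup>2))"
proof -
  have "1 - (norm (linepath a b t))\<^sup>2 \<noteq> 0" if "t \<in> {0..1}" for t
    using norm_linepath_less_1[OF assms that] abs_square_less_1[of "norm (linepath a b t)"] by simp
  then show ?thesis
    by (intro continuous_intros continuous_on_linepath) auto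
qed

lemma hyperbolic_length_subsegment:
  assumes "norm a < 1" "norm b < 1" "0 \<le> p" "p \<le> q" "q \<le> 1"
  shows "((\<lambda>t. 2 * norm (b - a) / (1 - (norm (linepath a b t))\<^sup>2)) has_integral
            hyperbolic_length (linepath a b p) (linepath a b q)) {p..q}"
proof (cases "p = q")
  case True
  then show ?thesis by (simp add: hyperbolic_length_def has_integral_refl)
next
  case False
  then have pq: "q - p > 0" using assms by simp
  define g where "g t = 2 * norm (b - a) / (1 - (norm (linepath a b t))\<^sup>2)" for t
  have "g integrable_on {p..q}"
    unfolding g_def
    using continuous_on_subset[OF hyperbolic_density_continuous[OF assms(1,2)], of "{p..q}"] assms
    by (intro integrable_continuous_real) auto
  then have I: "(g has_integral integral {p..q} g) (cbox p q)"
    by (simp add: integrable_integral)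
  have "((\<lambda>x. g ((q - p) * x + p)) has_integral integral {p..q} g / (q - p)) {0..1}"
    using has_integral_affinity'[OF I pq, of p] pq by (simp add: divide_inverse mult.commute)
  then have "((\<lambda>x. (q - p) * g ((q - p) * x + p)) has_integral
      (q - p) * (integral {p..q} g / (q - p))) {0..1}"
    by (rule has_integral_mult_right)
  then have H: "((\<lambda>x. (q - p) * g ((q - p) * x + p)) has_integral integral {p..q} g) {0..1}"
    using pq by simp
  have lp: "linepath (linepath a b p) (linepath a b q) x = linepath a b ((q - p) * x + p)" for x
    by (simp add: linepath_def algebra_simps scaleR_conv_of_real)
  have "linepath a b q - linepath a b p = (q - p) *\<^sub>R (b - a)"
    by (simp add: linepath_def algebra_simps)
  then have n: "norm (linepath a b q - linepath a b p) = (q - p) * norm (b - a)"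
    using pq by simp
  have "hyperbolic_length (linepath a b p) (linepath a b q) = integral {p..q} g"
    unfolding hyperbolic_length_def lp n
    using integral_unique[OF H] by (simp add: g_def mult.left_commute)
  then show ?thesis
    using I by (simp add: g_def[abs_def])
qed

lemma hyperbolic_length_commute:
  assumes "norm a < 1" "norm b < 1"
  shows "hyperbolic_length b a = hyperbolic_length a b"
proof -
  define g where "g t = 2 * norm (b - a) / (1 - (norm (linepath a b t))\<^sup>2)" for t
  have I: "(g has_integral hyperbolic_length a b) (cbox 0 1)"
    using hyperbolic_length_subsegment[OF assms, of 0 1]
    by (simp add: g_def[abs_def] linepath_0' linepath_1')
  have im: "(\<lambda>x::real. 1 - x) ` {0..1} = {0..1}"
    by (auto simp: image_iff intro!: bexI[where x="1 - _"])
  have "((\<lambda>x. g (1 - x)) has_integral hyperbolic_length a b) {0..1}"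
    using has_integral_affinity[OF I, of "-1" 1] by (simp add: im)
  moreover have "(\<lambda>x. g (1 - x)) = (\<lambda>x. 2 * norm (a - b) / (1 - (norm (linepath b a x))\<^sup>2))"
    by (simp add: g_def linepath_def norm_minus_commute add.commute)
  ultimately show ?thesis
    by (simp only: hyperbolic_length_def[of b a] integral_unique)
qed

lemma closed_segment_endpoints:
  fixes a b c d :: complex
  assumes "closed_segment a b = closed_segment c d"
  shows "(a = c \<and> b = d) \<or> (a = d \<and> b = c)"
proof -
  have "{a, b} = {c, d}"
    using extreme_point_of_segment[of _ a b] extreme_point_of_segment[of _ c d] assms by auto
  then show ?thesis by (auto simp: doubleton_eq_iff)
qed

lemma hyperbolic_length_set:
  assumes "norm a < 1" "norm b < 1" "closed_segment a b = closed_segment c d"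
  shows "hyperbolic_length a b = hyperbolic_length c d"
  using closed_segment_endpoints[OF assms(3)] hyperbolic_length_commute[OF assms(1,2)] by metis

lemma sum_hyperbolic_length_unique:
  assumes "segment_decomposition S A" "segment_decomposition S' A"
  shows "(\<Sum>(a, b)\<in>S. hyperbolic_length a b) = (\<Sum>(a, b)\<in>S'. hyperbolic_length a b)"
proof -
  define L where "L X = (if X = {} then 0 else
    (THE l. \<exists>a b. norm a < 1 \<and> norm b < 1 \<and> X = closed_segment a b \<and> l = hyperbolic_length a b))"
    for X :: "complex set"
  have L: "L (closed_segment a b) = hyperbolic_length a b" if "norm a < 1" "norm b < 1" for a b
  proof -
    have "(THE l. \<exists>c d. norm c < 1 \<and> norm d < 1 \<and> closed_segment a b = closed_segment c d \<and>
        l = hyperbolic_length c d) = hyperbolic_length a b"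
    proof (rule the_equality)
      show "\<exists>c d. norm c < 1 \<and> norm d < 1 \<and> closed_segment a b = closed_segment c d \<and>
          hyperbolic_length a b = hyperbolic_length c d"
        using that by blast
    qed (metis hyperbolic_length_set that)
    then show ?thesis by (simp add: L_def)
  qed
  define seg :: "complex \<times> complex \<Rightarrow> complex set"
    where "seg p = closed_segment (fst p) (snd p)" for p
  have main: "hyperbolic_length a b = (\<Sum>T\<in>S'. L (closed_segment a b \<inter> seg T))"
    if "segment_decomposition S' A" and sub: "closed_segment a b \<subseteq> A"
      and ab: "norm a < 1" "norm b < 1" "a \<noteq> b" for S' a b
  proof -
    define g where "g t = 2 * norm (b - a) / (1 - (norm (linepath a b t))\<^sup>2)" for t
    define B where "B T = {0..1} \<inter> linepath a b -` seg T" for T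
    have inj: "inj (linepath a b)"
    proof (rule injI)
      fix t u assume "linepath a b t = linepath a b u"
      then have "(t - u) *\<^sub>R (b - a) = 0"
        by (simp add: linepath_def algebra_simps)
      then show "t = u" using ab(3) by simp
    qed
    have imB: "linepath a b ` B T = closed_segment a b \<inter> seg T" for T
      unfolding B_def linepath_image_01[symmetric] by auto
    have gB: "(g has_integral L (closed_segment a b \<inter> seg T)) (B T)" for T
    proof (cases "B T = {}")
      case True
      then show ?thesis using imB[of T] by (simp add: L_def)
    next
      case False
      have "compact (B T)"
        unfolding B_def seg_def
        by (intro compact_Int_closed compact_Icc closed_vimage closed_segment continuous_on_linepath)
      moreover have "convex (B T)"
      proof -
        have "linepath a b -` seg T = (\<lambda>t. t *\<^sub>R (b - a)) -` ((\<lambda>z. z - a) ` seg T)"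
          by (auto simp: linepath_def algebra_simps image_iff
              intro!: bexI[where x = "a + _ *\<^sub>R b - _ *\<^sub>R a"] add.commute)
        moreover have "convex \<dots>"
          by (intro convex_linear_vimage) (auto simp: seg_def linear_iff algebra_simps convex_translation_subtract)
        ultimately show ?thesis
          unfolding B_def by (intro convex_Int) auto
      qed
      ultimately obtain p q where pq: "B T = {p..q}"
        using connected_compact_interval_1 convex_connected by metis
      with False have "p \<le> q" by auto
      moreover have "{p..q} \<subseteq> {0..1}" using pq B_def by blast
      ultimately have pq': "0 \<le> p" "p \<le> q" "q \<le> 1" by auto
      have "closed_segment a b \<inter> seg T = linepath a b ` closed_segment p q"
        using imB[of T] pq pq' by (simp add: closed_segment_eq_real_ivl1)
      also have "\<dots> = closed_segment (linepath a b p) (linepath a b q)"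
      proof -
        have "linepath a b = (\<lambda>z. a + z) \<circ> (\<lambda>t. t *\<^sub>R (b - a))"
          by (auto simp: linepath_def algebra_simps)
        moreover have "linear (\<lambda>t. t *\<^sub>R (b - a))"
          by (auto simp: linear_iff algebra_simps)
        ultimately show ?thesis
          by (metis closed_segment_linear_image closed_segment_translation image_comp o_apply)
      qed
      finally show ?thesis
        using hyperbolic_length_subsegment[OF ab(1,2) pq'] norm_linepath_less_1[OF ab(1,2)] pq pq' L
        by (simp add: g_def[abs_def])
    qed
    have fin: "finite S'" and A: "A = (\<Union>T\<in>S'. seg T)"
      and disj: "\<And>T T'. T \<in> S' \<Longrightarrow> T' \<in> S' \<Longrightarrow> T \<noteq> T' \<Longrightarrow> seg T \<inter> seg T' \<subseteq> {fst T, snd T}"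
      using that(1) unfolding segment_decomposition_def seg_def by (auto, blast+)
    have "(g has_integral (\<Sum>T\<in>S'. L (closed_segment a b \<inter> seg T))) (\<Union>T\<in>S'. B T)"
    proof (rule has_integral_UN[OF fin gB], rule pairwiseI)
      fix T T' assume "T \<in> S'" "T' \<in> S'" "T \<noteq> T'"
      then have "B T \<inter> B T' \<subseteq> linepath a b -` {fst T, snd T}"
        using disj unfolding B_def by blast
      moreover have "finite (linepath a b -` {fst T, snd T})"
        using inj by (intro finite_vimageI) auto
      ultimately show "negligible (B T \<inter> B T')"
        using finite_subset negligible_finite by blast
    qed
    moreover have "(\<Union>T\<in>S'. B T) = {0..1}"
      using sub unfolding B_def A linepath_image_01[symmetric] by fastforce
    moreover have "(g has_integral hyperbolic_length a b) {0..1}"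
      using hyperbolic_length_subsegment[OF ab(1,2), of 0 1]
      by (simp add: g_def[abs_def] linepath_0' linepath_1')
    ultimately show ?thesis using has_integral_unique by metis
  qed
  have D: "(\<Sum>(a, b)\<in>S. hyperbolic_length a b) = (\<Sum>T\<in>S. \<Sum>T'\<in>S'. L (seg T \<inter> seg T'))"
    if S: "segment_decomposition S A" and S': "segment_decomposition S' A" for S S'
  proof (rule sum.cong[OF refl])
    fix T assume T: "T \<in> S"
    obtain a b where ab: "T = (a, b)" by (cases T)
    have "norm a < 1" "norm b < 1" "a \<noteq> b" "closed_segment a b \<subseteq> A"
      using S T unfolding segment_decomposition_def ab by auto
    from main[OF S' this(4) this(1-3)]
    show "(case T of (a, b) \<Rightarrow> hyperbolic_length a b) = (\<Sum>T'\<in>S'. L (seg T \<inter> seg T'))"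
      by (simp add: ab seg_def)
  qed
  have "(\<Sum>(a, b)\<in>S. hyperbolic_length a b) = (\<Sum>T\<in>S. \<Sum>T'\<in>S'. L (seg T \<inter> seg T'))"
    by (rule D[OF assms])
  also have "\<dots> = (\<Sum>T'\<in>S'. \<Sum>T\<in>S. L (seg T' \<inter> seg T))"
    by (subst sum.swap) (simp add: Int_commute)
  also have "\<dots> = (\<Sum>(a, b)\<in>S'. hyperbolic_length a b)"
    by (rule D[OF assms(2,1), symmetric])
  finally show ?thesis .
qed

theorem hyperbolic_perimeter_eq:
  assumes "segment_decomposition S A"
  shows "hyperbolic_perimeter A = 2 * (\<Sum>(a, b)\<in>S. hyperbolic_length a b)"
  unfolding hyperbolic_perimeter_def
proof (rule the_equality)
  show "\<exists>S'. segment_decomposition S' A \<and>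
      2 * (\<Sum>(a, b)\<in>S. hyperbolic_length a b) = 2 * (\<Sum>(a, b)\<in>S'. hyperbolic_length a b)"
    using assms by blast
qed (metis sum_hyperbolic_length_unique assms)

lemma hyperbolic_length_0:
  assumes "norm z < 1"
  shows "hyperbolic_length 0 z = 2 * artanh (norm z)"
proof -
  have "((\<lambda>t. 2 * norm z / (1 - (t * norm z)\<^sup>2)) has_integral
          2 * artanh (1 * norm z) - 2 * artanh (0 * norm z)) {0..1}"
  proof (rule fundamental_theorem_of_calculus)
    fix t :: real assume t: "t \<in> {0..1}"
    have "t * norm z \<le> norm z" using t by (simp add: mult_left_le_one_le)
    moreover have "0 \<le> t * norm z" using t by simp
    ultimately have "\<bar>t * norm z\<bar> < 1" using assms by linarith
    then show "((\<lambda>t. 2 * artanh (t * norm z)) has_vector_derivative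
        2 * norm z / (1 - (t * norm z)\<^sup>2)) (at t within {0..1})"
      unfolding has_real_derivative_iff_has_vector_derivative[symmetric]
      by (auto intro!: derivative_eq_intros DERIV_chain2[OF artanh_real_has_field_derivative])
  qed simp
  moreover have "(\<lambda>t. 2 * norm (z - 0) / (1 - (norm (linepath 0 z t))\<^sup>2)) =
      (\<lambda>t. 2 * norm z / (1 - (t * norm z)\<^sup>2))"
    by (simp add: linepath_def power_mult_distrib)
  ultimately show ?thesis
    by (simp only: hyperbolic_length_def integral_unique) simp
qed

text \<open>Agreement with \<open>sinh\<^sup>2 (\<rho>(x, y) / 2) = |x - y|\<^sup>2 / ((1 - |x|\<^sup>2) (1 - |y|\<^sup>2))\<close> at \<open>x = 0\<close>.\<close>

lemma sinh_hyperbolic_length_0: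
  assumes "norm z < 1"
  shows "(sinh (hyperbolic_length 0 z / 2))\<^sup>2 = (norm z)\<^sup>2 / (1 - (norm z)\<^sup>2)"
proof -
  define x where "x = artanh (norm z)"
  have "tanh x = norm z"
  proof -
    define q where "q = (1 + norm z) / (1 - norm z)"
    have q: "q > 0" unfolding q_def using assms by (intro divide_pos_pos add_pos_nonneg) auto
    have "x = ln (sqrt q)"
      using q by (simp add: x_def artanh_def q_def[symmetric] ln_sqrt)
    then have "tanh x = (q - 1) / (q + 1)"
      using q tanh_ln_real[of "sqrt q"] by simp
    moreover have "q - 1 = norm z * (2 / (1 - norm z))" "q + 1 = 2 / (1 - norm z)"
      using assms by (simp_all add: q_def field_simps)
    ultimately show ?thesis using assms by simp
  qed
  moreover have "(cosh x)\<^sup>2 = 1 + (sinh x)\<^sup>2" by (simp add: cosh_square_eq)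
  ultimately have "(norm z)\<^sup>2 = (sinh x)\<^sup>2 / (1 + (sinh x)\<^sup>2)"
    by (metis power_divide tanh_def)
  moreover have "y = (y / (1 + y)) / (1 - y / (1 + y))" if "y \<ge> 0" for y :: real
    using that by (simp add: field_simps)
  ultimately have "(sinh x)\<^sup>2 = (norm z)\<^sup>2 / (1 - (norm z)\<^sup>2)"
    by simp
  then show ?thesis
    using hyperbolic_length_0[OF assms] by (simp add: x_def)
qed

lemma hyperbolic_perimeter_radius:
  assumes "0 < r" "r < 1"
  shows "hyperbolic_perimeter (closed_segment 0 (of_real r)) = 4 * artanh r"
proof -
  have "segment_decomposition {(0, of_real r)} (closed_segment 0 (of_real r))"
    using assms by (auto simp: segment_decomposition_def)
  from hyperbolic_perimeter_eq[OF this] show ?thesis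
    using hyperbolic_length_0[of "of_real r"] assms by simp
qed

lemma hyperbolic_perimeter_star:
  assumes "m \<ge> 1" "0 < s" "s < 1"
  shows "hyperbolic_perimeter (star m s) = 2 * real m * ln ((1 + s) / (1 - s))"
proof -
  define w where "w k = of_real s * cis (2 * pi * real k / real m)" for k
  have nw: "norm (w k) = s" for k using assms by (simp add: w_def norm_mult)
  have w0: "w k \<noteq> 0" for k using nw[of k] assms by auto
  have inj: "inj_on w {1..m}"
  proof (rule inj_onI)
    fix k l assume kl: "k \<in> {1..m}" "l \<in> {1..m}" "w k = w l"
    then have "cis (2 * pi * real k / real m - 2 * pi * real l / real m) = 1"
      using assms by (simp add: w_def cis_divide[symmetric])
    then have "cos (2 * pi * real k / real m - 2 * pi * real l / real m) = 1"
      by (simp add: complex_eq_iff)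
    then obtain n :: int where
      n: "2 * pi * real k / real m - 2 * pi * real l / real m = of_int n * 2 * pi"
      using cos_one_2pi_int by auto
    have "2 * pi * (real k - real l) = 2 * pi * (of_int n * real m)"
      using n assms by (simp add: field_simps)
    then have "real k - real l = of_int n * real m" by simp
    then have e: "int k - int l = n * int m"
      by (metis (mono_tags, lifting) of_int_diff of_int_eq_iff of_int_mult of_int_of_nat_eq)
    moreover have "\<bar>int k - int l\<bar> < int m" using kl by auto
    ultimately have "\<bar>n\<bar> * int m < 1 * int m" by (simp add: abs_mult)
    then have "n = 0" by (subst (asm) mult_less_cancel_right) auto
    with e show "k = l" by simp
  qed
  have dec: "segment_decomposition ((\<lambda>k. (0, w k)) ` {1..m}) (star m s)"
    unfolding segment_decomposition_def
  proof (intro conjI)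
    have "closed_segment 0 (w k) \<inter> closed_segment 0 (w l) \<subseteq> {0}" if "w k \<noteq> w l" for k l
    proof
      fix x assume "x \<in> closed_segment 0 (w k) \<inter> closed_segment 0 (w l)"
      then obtain t u where tu: "0 \<le> t" "0 \<le> u" "x = t *\<^sub>R w k" "x = u *\<^sub>R w l"
        by (auto simp: in_segment)
      then have "t * s = u * s" using nw by (metis abs_of_nonneg norm_scaleR)
      then have "t = u" using assms by simp
      then show "x \<in> {0}" using tu that by auto
    qed
    then show "\<forall>(a, b)\<in>(\<lambda>k. (0, w k)) ` {1..m}. \<forall>(c, d)\<in>(\<lambda>k. (0, w k)) ` {1..m}.
       (a, b) \<noteq> (c, d) \<longrightarrow> closed_segment a b \<inter> closed_segment c d \<subseteq> {a, b} \<inter> {c, d}"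
      by blast
  qed (use assms nw w0 in \<open>auto simp: star_def w_def\<close>)
  have "inj_on (\<lambda>k. (0::complex, w k)) {1..m}"
    using inj unfolding inj_on_def by blast
  then show ?thesis
    using hyperbolic_perimeter_eq[OF dec] assms nw
    by (simp add: sum.reindex hyperbolic_length_0 artanh_def)
qed

text \<open>Hence the radius \<open>r\<close> with prescribed perimeter of \<open>[0, r]\<close> is unique.\<close>

lemma ex1_radius_perimeter_star:
  assumes "m \<ge> 1" "0 < s" "s < 1"
  shows "\<exists>!r. 0 < r \<and> r < 1 \<and>
    hyperbolic_perimeter (closed_segment 0 (of_real r)) = hyperbolic_perimeter (star m s)"
proof -
  define x where "x = real m * ln ((1 + s) / (1 - s)) / 2"
  have "ln ((1 + s) / (1 - s)) > 0"
    using assms by (intro ln_gt_zero) (simp add: field_simps)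
  then have "x > 0" using assms by (simp add: x_def)
  then have "0 < tanh x" "tanh x < 1"
    by (simp_all add: tanh_real_lt_1)
  moreover have "hyperbolic_perimeter (closed_segment 0 (of_real r)) = hyperbolic_perimeter (star m s)
      \<longleftrightarrow> artanh r = x" if "0 < r" "r < 1" for r
    unfolding hyperbolic_perimeter_radius[OF that] hyperbolic_perimeter_star[OF assms] x_def by auto
  moreover have "q = r" if "artanh q = artanh r" "0 < q" "q < 1" "0 < r" "r < 1" for q r :: real
  proof -
    have "(1 + q) / (1 - q) = (1 + r) / (1 - r)"
      using that by (simp add: artanh_def)
    then show ?thesis using that by (simp add: field_simps)
  qed
  ultimately show ?thesis
    by (intro ex1I[where a = "tanh x"]) (simp add: artanh_tanh_real, metis artanh_tanh_real)
qed

end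

theory Submission
  imports Defs
begin

text \<open>For \<open>s = 1/2\<close> all stars lie in the disk of radius \<open>1/2\<close>, so that a single bump function bounds
  \<open>c(m, 1/2)\<close> uniformly in \<open>m\<close>. The perimeter of the star, and with it the radius \<open>r\<close>, tends to
  \<open>\<infinity>\<close> and \<open>1\<close>, respectively, as \<open>m \<rightarrow> \<infinity>\<close>. Finally \<open>cap(B, [0, r]) \<ge> 1/2 log (1 / (1 - r))\<close>:
  an admissible \<open>u\<close> drops from \<open>1\<close> to \<open>0\<close> along the diagonal line \<open>t + (1 + \<i>) \<lambda>\<close>,
  \<open>0 \<le> \<lambda> \<le> 1 - t\<close>, hence this line carries energy at least \<open>1 / (2 (1 - t))\<close>, and
  these lines foliate a part of the disk as \<open>t\<close> runs through \<open>[0, r]\<close>.\<close>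

section \<open>Gradients\<close>

lemma gradient_inner:
  assumes "u differentiable (at z)"
  shows "gradient u z \<bullet> v = frechet_derivative u (at z) v"
proof -
  interpret linear "frechet_derivative u (at z)"
    using assms by (rule linear_frechet_derivative)
  have "frechet_derivative u (at z) v = frechet_derivative u (at z) (\<Sum>b\<in>Basis. (v \<bullet> b) *\<^sub>R b)"
    by (simp add: euclidean_representation)
  also have "\<dots> = gradient u z \<bullet> v"
    by (simp add: gradient_def sum scale inner_sum_right inner_commute[of _ v] mult.commute)
  finally show ?thesis by simp
qed

lemma continuous_on_gradient:
  assumes "Ck_on 1 u S"
  shows "continuous_on S (gradient u)"
  using assms unfolding gradient_def[abs_def] by (auto intro!: continuous_intros)


section \<open>A bump function\<close>

text \<open>The index \<open>0\<close> gives the classical smooth function vanishing to infinite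
  order at \<open>0\<close>. The factors \<open>1 / x ^ n\<close> close the family under
  differentiation, up to linear combinations.\<close>

definition flat :: "nat \<Rightarrow> real \<Rightarrow> real" where
  "flat n x = (if x > 0 then exp (- 1 / x) / x ^ n else 0)"

lemma flat_nonneg: "0 \<le> flat n x"
  by (simp add: flat_def)

text \<open>With \<open>y = 1 / x\<close>, the decay of \<open>exp (- y)\<close> beats the growth of
  \<open>y ^ n\<close>.\<close>

lemma tendsto_flat_0: "(flat n \<longlongrightarrow> 0) (at 0)"
proof -
  have "((\<lambda>x. inverse x ^ n / exp (inverse x)) \<longlongrightarrow> 0) (at_right (0::real))"
    by (rule filterlim_compose[OF tendsto_power_div_exp_0 filterlim_inverse_at_top_right])
  moreover have "eventually (\<lambda>x. inverse x ^ n / exp (inverse x) = flat n x) (at_right 0)"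
    unfolding eventually_at_right_field
    by (intro exI[of _ 1]) (auto simp: flat_def exp_minus field_simps)
  ultimately have "(flat n \<longlongrightarrow> 0) (at_right 0)"
    by (rule Lim_transform_eventually)
  moreover have "(flat n \<longlongrightarrow> 0) (at_left 0)"
    by (rule tendsto_eventually) (auto simp: flat_def eventually_at_left_field intro!: exI[of _ "-1"])
  ultimately show ?thesis
    by (simp add: filterlim_split_at)
qed

lemma has_real_derivative_flat:
  "(flat n has_real_derivative flat (n + 2) x - real n * flat (n + 1) x) (at x)"
proof -
  consider "x < 0" | "x = 0" | "x > 0" by linarith
  then show ?thesis
  proof cases
    case 1
    have "((\<lambda>_. 0) has_real_derivative 0) (at x)" by simp
    then have "(flat n has_real_derivative 0) (at x)"
      by (rule has_field_derivative_transform_within_open[where S = "{..<0}"])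
        (use 1 in \<open>auto simp: flat_def\<close>)
    with 1 show ?thesis by (simp add: flat_def)
  next
    case 2
    \<comment> \<open>The difference quotient of \<open>flat n\<close> at \<open>0\<close> is
      \<open>flat (Suc n)\<close>.\<close>
    have "((\<lambda>y. (flat n y - flat n 0) / (y - 0)) \<longlongrightarrow> 0) (at 0)"
      by (rule Lim_transform_eventually[OF tendsto_flat_0[of "Suc n"]])
        (auto simp: flat_def eventually_at intro!: exI[of _ 1])
    with 2 show ?thesis by (simp add: has_field_derivative_iff flat_def)
  next
    case 3
    \<comment> \<open>The form \<open>x ^ n / x\<close> covers \<open>n = 0\<close> without a
      truncated exponent.\<close>
    have "((\<lambda>y. y ^ n) has_real_derivative real n * x ^ n / x) (at x)"
      using DERIV_pow[of n x] 3 by (cases n) auto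
    moreover have "((\<lambda>y. exp (- 1 / y)) has_real_derivative exp (- 1 / x) / x\<^sup>2) (at x)"
      using 3 by (auto intro!: derivative_eq_intros simp: power2_eq_square)
    ultimately have "((\<lambda>y. exp (- 1 / y) / y ^ n) has_real_derivative
        flat (n + 2) x - real n * flat (n + 1) x) (at x)"
      using 3
      by (auto intro!: DERIV_cong[OF DERIV_divide] simp: flat_def field_simps power2_eq_square)
    then show ?thesis
      by (rule has_field_derivative_transform_within_open[where S = "{0<..}"])
        (use 3 in \<open>auto simp: flat_def\<close>)
  qed
qed

text \<open>An algebra of functions that contains the bump function and is closed under directional
  derivatives, hence consists of smooth functions.\<close>

inductive_set flat_algebra :: "('a::real_inner \<Rightarrow> real) set" where
  const: "(\<lambda>_. c) \<in> flat_algebra"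
| inner: "(\<lambda>z. z \<bullet> v) \<in> flat_algebra"
| flat: "(\<lambda>z. flat n (1/2 - z \<bullet> z)) \<in> flat_algebra"
| add: "f \<in> flat_algebra \<Longrightarrow> g \<in> flat_algebra \<Longrightarrow> (\<lambda>z. f z + g z) \<in> flat_algebra"
| mult: "f \<in> flat_algebra \<Longrightarrow> g \<in> flat_algebra \<Longrightarrow> (\<lambda>z. f z * g z) \<in> flat_algebra"

text \<open>In \<open>D v z\<close> the direction comes first: for fixed \<open>v\<close> the
  derivative is a function of the point and lies in the algebra again, which is what
  \<open>Ck_on\<close> iterates.\<close>

lemma flat_algebra_derivative:
  assumes "f \<in> flat_algebra"
  shows "\<exists>D. (\<forall>z. (f has_derivative (\<lambda>v. D v z)) (at z)) \<and> (\<forall>v. D v \<in> flat_algebra)"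
  using assms
proof induction
  case (const c)
  show ?case
    by (rule exI[of _ "\<lambda>_ _. 0"]) (auto intro: flat_algebra.const)
next
  case (inner w)
  show ?case
    by (rule exI[of _ "\<lambda>v _. v \<bullet> w"]) (auto intro!: flat_algebra.const derivative_eq_intros)
next
  case (flat n)
  \<comment> \<open>Signs are absorbed into constant factors so that the closure rules apply
    literally.\<close>
  define D where "D v z =
    (flat (n + 2) (1/2 - z \<bullet> z) + (- real n) * flat (n + 1) (1/2 - z \<bullet> z)) * ((-2) * (z \<bullet> v))"
    for v z :: 'a
  have "((\<lambda>z. flat n (1/2 - z \<bullet> z)) has_derivative (\<lambda>v. D v z)) (at z)" for z :: 'a
  proof -
    have "((\<lambda>z. 1/2 - z \<bullet> z) has_derivative (\<lambda>v. (-2) * (z \<bullet> v))) (at z)"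
      by (auto intro!: derivative_eq_intros simp: inner_commute)
    from has_derivative_compose[OF this
        has_real_derivative_flat[unfolded has_field_derivative_def, of n "1/2 - z \<bullet> z"]]
    show ?thesis by (simp add: D_def)
  qed
  moreover have "D v \<in> flat_algebra" for v
    unfolding D_def by (intro flat_algebra.intros)
  ultimately show ?case by blast
next
  case (add f g)
  then obtain D E where
    "\<And>z. (f has_derivative (\<lambda>v. D v z)) (at z)" "\<And>v. D v \<in> flat_algebra"
    "\<And>z. (g has_derivative (\<lambda>v. E v z)) (at z)" "\<And>v. E v \<in> flat_algebra"
    by metis
  then show ?case
    by (intro exI[of _ "\<lambda>v z. D v z + E v z"] conjI allI has_derivative_add flat_algebra.add)
next
  case (mult f g)
  then obtain D E where
    "\<And>z. (f has_derivative (\<lambda>v. D v z)) (at z)" "\<And>v. D v \<in> flat_algebra"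
    "\<And>z. (g has_derivative (\<lambda>v. E v z)) (at z)" "\<And>v. E v \<in> flat_algebra"
    by metis
  with mult.hyps show ?case
    by (intro exI[of _ "\<lambda>v z. f z * E v z + D v z * g z"] conjI allI has_derivative_mult
        flat_algebra.add flat_algebra.mult)
qed

lemma Ck_on_flat_algebra:
  assumes "f \<in> flat_algebra"
  shows "Ck_on k f S"
  using assms
proof (induction k arbitrary: f)
  case 0
  then show ?case
    using flat_algebra_derivative has_derivative_continuous
    by (auto intro!: continuous_at_imp_continuous_on) blast
next
  case (Suc k)
  then obtain D where D: "\<And>z. (f has_derivative (\<lambda>v. D v z)) (at z)" "\<And>v. D v \<in> flat_algebra"
    using flat_algebra_derivative by blast
  have "frechet_derivative f (at z) = (\<lambda>v. D v z)" for z
    using frechet_derivative_at[OF D(1)] by simp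
  moreover have "f differentiable (at z)" for z
    using D(1) differentiableI by blast
  ultimately show ?case
    using Suc.IH[OF D(2)] by simp
qed

text \<open>One test function serves every \<open>E\<close>, so \<open>C\<close> is chosen before
  \<open>E\<close>; for stars this makes the bound independent of the number of rays.\<close>

lemma capacity_small_disk_finite:
  "\<exists>C::real. \<forall>E \<subseteq> cball 0 (1/2). capacity (ball 0 1) E \<le> ennreal C"
proof -
  \<comment> \<open>On the disk of radius \<open>1/2\<close> the argument of \<open>flat 0\<close>
    is at least \<open>1/4\<close>, so the factor \<open>exp 4\<close> lifts \<open>u\<close> to at
    least \<open>1\<close>. Since \<open>1/2 < (3/4)\<^sup>2\<close>, \<open>u\<close> vanishes off
    the disk of radius \<open>3/4\<close>.\<close>
  define u :: "complex \<Rightarrow> real" where "u = (\<lambda>z. exp 4 * flat 0 (1/2 - z \<bullet> z))"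
  have "u \<in> flat_algebra"
    unfolding u_def by (intro flat_algebra.intros)
  then have smooth: "Ck_on k u S" for k S
    by (rule Ck_on_flat_algebra)
  have "u z = 0" if "z \<notin> cball 0 (3/4)" for z
  proof -
    have "(3/4)\<^sup>2 < (norm z)\<^sup>2"
      using that by (intro power_strict_mono) auto
    then show ?thesis
      by (simp add: u_def flat_def dot_square_norm power2_eq_square)
  qed
  then have supp: "smooth_compact_support_on (ball 0 1) u"
    unfolding smooth_compact_support_on_def using smooth
    by (auto intro!: exI[of _ "cball 0 (3/4)"])
  have ge1: "1 \<le> u z" if "z \<in> cball 0 (1/2)" for z
  proof -
    have "(norm z)\<^sup>2 \<le> (1/2)\<^sup>2"
      using that by (intro power_mono) auto
    then have q: "1/4 \<le> 1/2 - z \<bullet> z"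
      by (simp add: dot_square_norm power2_eq_square)
    then have "1 / (1/2 - z \<bullet> z) \<le> 4"
      by (simp add: field_simps)
    then have "exp 4 * exp (-4) \<le> exp 4 * exp (- 1 / (1/2 - z \<bullet> z))"
      by simp
    with q show ?thesis by (simp add: u_def flat_def exp_minus)
  qed
  \<comment> \<open>As \<open>u\<close> is smooth on the whole plane, compactness of the closed disk
    bounds the energy density.\<close>
  have "continuous_on (cball 0 1) (\<lambda>z. (norm (gradient u z))\<^sup>2)"
    by (intro continuous_intros continuous_on_gradient smooth)
  then have "bounded ((\<lambda>z. (norm (gradient u z))\<^sup>2) ` cball 0 1)"
    by (intro compact_imp_bounded compact_continuous_image compact_cball)
  then obtain B where B: "0 < B" "\<And>z. z \<in> cball 0 1 \<Longrightarrow> (norm (gradient u z))\<^sup>2 \<le> B"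
    unfolding bounded_pos by fastforce
  have "capacity (ball 0 1) E \<le> ennreal (B * measure lborel (ball (0::complex) 1))"
    if "E \<subseteq> cball 0 (1/2)" for E
  proof -
    have "capacity (ball 0 1) E \<le> (\<integral>\<^sup>+z\<in>ball 0 1. ennreal ((norm (gradient u z))\<^sup>2) \<partial>lborel)"
      unfolding capacity_def
      by (rule INF_lower) (use supp ge1 that in \<open>auto simp: u_def flat_nonneg\<close>)
    also have "\<dots> \<le> (\<integral>\<^sup>+z. ennreal B * indicator (ball (0::complex) 1) z \<partial>lborel)"
      using B(2) by (intro nn_integral_mono) (auto simp: indicator_def intro!: ennreal_leI)
    also have "\<dots> = ennreal B * emeasure lborel (ball (0::complex) 1)"
      by (intro nn_integral_cmult_indicator) simp
    also have "\<dots> = ennreal (B * measure lborel (ball (0::complex) 1))"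
      using B(1) emeasure_lborel_ball_finite[of "0::complex" 1]
      by (simp add: emeasure_eq_ennreal_measure ennreal_mult)
    finally show ?thesis .
  qed
  then show ?thesis by blast
qed


section \<open>Lower bound for the capacity of a radius\<close>

lemma measurable_Complex [measurable (raw)]:
  "f \<in> borel_measurable M \<Longrightarrow> g \<in> borel_measurable M \<Longrightarrow> (\<lambda>x. Complex (f x) (g x)) \<in> borel_measurable M"
  by (simp add: borel_measurable_complex_iff)

text \<open>Lebesgue measure is determined by its values on boxes, and the preimage of a box under
  the coordinate map is a product of intervals.\<close>

lemma lborel_complex_eq_distr:
  "(lborel :: complex measure) = distr (lborel \<Otimes>\<^sub>M lborel) borel (\<lambda>(x, y). Complex x y)"
proof (rule lborel_eqI)
  fix l u :: complex
  assume le: "\<And>b. b \<in> Basis \<Longrightarrow> l \<bullet> b \<le> u \<bullet> b"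
  have "(\<lambda>(x, y). Complex x y) -` box l u \<inter> space (lborel \<Otimes>\<^sub>M lborel) =
      box (Re l) (Re u) \<times> box (Im l) (Im u)"
    by (auto simp: space_pair_measure box_def Basis_complex_def)
  then show "emeasure (distr (lborel \<Otimes>\<^sub>M lborel) borel (\<lambda>(x, y). Complex x y)) (box l u) =
      (\<Prod>b\<in>Basis. (u - l) \<bullet> b)"
    using le[of 1] le[of \<i>]
    by (simp add: emeasure_distr lborel.emeasure_pair_measure_Times Basis_complex_def ennreal_mult)
qed simp

text \<open>The shear \<open>(t, l) \<mapsto> (t + l, l)\<close> preserves area: translate the real
  part for fixed imaginary part, then apply Tonelli.\<close>

lemma nn_integral_complex_diagonal:
  assumes [measurable]: "f \<in> borel_measurable borel"
  shows "(\<integral>\<^sup>+z. f z \<partial>lborel) = (\<integral>\<^sup>+t. \<integral>\<^sup>+l. f (Complex (t + l) l) \<partial>lborel \<partial>lborel)"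
proof -
  have m1: "(\<lambda>p. f (case p of (x, y) \<Rightarrow> Complex x y)) \<in> borel_measurable (lborel \<Otimes>\<^sub>M lborel)"
    by measurable
  have m2: "(\<lambda>p. f (case p of (x, y) \<Rightarrow> Complex (x + y) y)) \<in> borel_measurable (lborel \<Otimes>\<^sub>M lborel)"
    by measurable
  have "(\<integral>\<^sup>+z. f z \<partial>lborel) =
      (\<integral>\<^sup>+p. f (case p of (x, y) \<Rightarrow> Complex x y) \<partial>(lborel \<Otimes>\<^sub>M lborel))"
    by (subst lborel_complex_eq_distr) (simp add: nn_integral_distr)
  also have "\<dots> = (\<integral>\<^sup>+y. \<integral>\<^sup>+x. f (Complex x y) \<partial>lborel \<partial>lborel)"
    using lborel_pair.nn_integral_snd[OF m1] by simp
  also have "\<dots> = (\<integral>\<^sup>+y. \<integral>\<^sup>+t. f (Complex (t + y) y) \<partial>lborel \<partial>lborel)"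
  proof (rule nn_integral_cong)
    fix y :: real
    show "(\<integral>\<^sup>+x. f (Complex x y) \<partial>lborel) = (\<integral>\<^sup>+t. f (Complex (t + y) y) \<partial>lborel)"
      using nn_integral_real_affine[of "\<lambda>x. f (Complex x y)" 1 y] by (simp add: add.commute)
  qed
  also have "\<dots> = (\<integral>\<^sup>+t. \<integral>\<^sup>+y. f (Complex (t + y) y) \<partial>lborel \<partial>lborel)"
    using lborel_pair.Fubini'[of "\<lambda>x y. f (Complex (x + y) y)"] m2 by (simp add: case_prod_unfold)
  finally show ?thesis .
qed

text \<open>The factor \<open>2\<close> is the squared length of the direction
  \<open>1 + \<i>\<close>. Energy is measured in the parameter \<open>l\<close>, the form that the
  shear produces.\<close>

lemma diagonal_energy:
  fixes u :: "complex \<Rightarrow> real"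
  assumes u: "smooth_compact_support_on (ball 0 1) u"
    and t: "0 \<le> t" "t < 1" and ut: "1 \<le> u (of_real t)"
  shows "ennreal (1 / (2 * (1 - t))) \<le>
    (\<integral>\<^sup>+l. ennreal ((norm (gradient u (Complex (t + l) l)))\<^sup>2) *
      indicator (ball 0 1) (Complex (t + l) l) \<partial>lborel)"
proof -
  define \<gamma> where "\<gamma> l = Complex (t + l) l" for l
  obtain K where K: "compact K" "K \<subseteq> ball 0 1" "\<And>z. z \<in> ball 0 1 - K \<Longrightarrow> u z = 0"
    and C1: "Ck_on 1 u (ball 0 1)"
    using u unfolding smooth_compact_support_on_def by blast
  have diff: "u differentiable (at z)" if "z \<in> ball 0 1" for z
    using C1 that by simp
  \<comment> \<open>A maximum of the norm on \<open>K\<close> exists only for nonempty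
    \<open>K\<close>; otherwise \<open>0\<close> serves.\<close>
  obtain \<rho> where \<rho>: "\<rho> < 1" "\<And>z. z \<in> K \<Longrightarrow> norm z \<le> \<rho>"
  proof (cases "K = {}")
    case True
    then show ?thesis using that[of 0] by simp
  next
    case False
    then obtain w where "w \<in> K" "\<And>z. z \<in> K \<Longrightarrow> norm z \<le> norm w"
      using continuous_attains_sup[OF K(1), of norm] continuous_on_norm_id by blast
    then show ?thesis using that[of "norm w"] K(2) by auto
  qed
  \<comment> \<open>The circle of radius \<open>\<sigma>\<close> lies in the disk but outside every
    point of \<open>K\<close>, so \<open>u\<close> vanishes on it. The path starts inside it, at
    norm \<open>t\<close>, and must cross it by parameter \<open>1 - t\<close>. Stopping there
    avoids the boundary, where nothing is known about \<open>u\<close>.\<close>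
  define \<sigma> where "\<sigma> = (1 + max \<rho> t) / 2"
  have \<sigma>: "\<rho> < \<sigma>" "t < \<sigma>" "\<sigma> < 1"
    using \<rho>(1) t by (auto simp: \<sigma>_def max_def field_simps)
  have cont\<gamma>: "continuous_on S \<gamma>" for S
    unfolding \<gamma>_def Complex_eq by (intro continuous_intros)
  have "1 \<le> norm (\<gamma> (1 - t))"
    by (simp add: \<gamma>_def cmod_def)
  moreover have "norm (\<gamma> 0) = t"
    using t by (simp add: \<gamma>_def cmod_def)
  ultimately obtain L where L: "0 \<le> L" "L \<le> 1 - t" "norm (\<gamma> L) = \<sigma>"
    using IVT'[of "\<lambda>l. norm (\<gamma> l)" 0 \<sigma> "1 - t"] \<sigma> t
    by (auto intro!: continuous_intros cont\<gamma>)
  have ball: "\<gamma> l \<in> ball 0 1" if "l \<in> {0..L}" for l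
  proof -
    \<comment> \<open>Both coordinates are nonnegative and nondecreasing along the path.\<close>
    have "norm (\<gamma> l) \<le> norm (\<gamma> L)"
      unfolding \<gamma>_def cmod_def using that t by (auto intro!: add_mono power_mono)
    then show ?thesis using L \<sigma> by simp
  qed
  have "\<gamma> L \<notin> K" using \<rho>(2) L(3) \<sigma>(1) by force
  then have uL: "u (\<gamma> L) = 0" using K(3) ball L(1) by auto
  define D where "D l = gradient u (\<gamma> l) \<bullet> Complex 1 1" for l
  have "((\<lambda>l. u (\<gamma> l)) has_vector_derivative D l) (at l within {0..L})" if l: "l \<in> {0..L}" for l
  proof -
    have "(\<gamma> has_derivative (\<lambda>h. h *\<^sub>R Complex 1 1)) (at l within {0..L})"
      unfolding \<gamma>_def Complex_eq
      by (auto intro!: derivative_eq_intros simp: scaleR_conv_of_real algebra_simps)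
    from has_derivative_compose[OF this
        frechet_derivative_works[THEN iffD1, OF diff[OF ball[OF l]]]]
    show ?thesis
      using linear_scale[OF linear_frechet_derivative[OF diff[OF ball[OF l]]]]
      by (simp add: has_vector_derivative_def D_def gradient_inner[OF diff[OF ball[OF l]]])
  qed
  then have I: "(D has_integral u (\<gamma> L) - u (\<gamma> 0)) {0..L}"
    using L(1) by (intro fundamental_theorem_of_calculus)
  have contD: "continuous_on {0..L} (\<lambda>l. gradient u (\<gamma> l))"
    using ball by (intro continuous_on_compose2[OF continuous_on_gradient[OF C1] cont\<gamma>]) auto
  then have "(\<lambda>l. (norm (gradient u (\<gamma> l)))\<^sup>2) integrable_on {0..L}"
    by (intro integrable_continuous_real continuous_intros)
  then have J: "((\<lambda>l. (norm (gradient u (\<gamma> l)))\<^sup>2) has_integral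
      integral {0..L} (\<lambda>l. (norm (gradient u (\<gamma> l)))\<^sup>2)) {0..L}"
    by (rule integrable_integral)
  \<comment> \<open>This value maximizes \<open>c - (1 - t) * c\<^sup>2 / 2\<close>, the bound
    obtained below; the maximum is \<open>c / 2\<close>.\<close>
  define c where "c = 1 / (1 - t)"
  have c: "c > 0" using t by (simp add: c_def)
  \<comment> \<open>The Cauchy-Schwarz inequality on the line, in the linearized form \<open>D\<^sup>2 \<ge> - 2 c D - c\<^sup>2\<close>.\<close>
  have lower: "((\<lambda>l. - c * D l - c\<^sup>2 / 2) has_integral
      - c * (u (\<gamma> L) - u (\<gamma> 0)) - L *\<^sub>R (c\<^sup>2 / 2)) {0..L}"
    using has_integral_const_real[of "c\<^sup>2 / 2" 0 L] L(1)
    by (intro has_integral_diff has_integral_mult_right I) simp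
  have "- c * (u (\<gamma> L) - u (\<gamma> 0)) - L *\<^sub>R (c\<^sup>2 / 2) \<le>
      integral {0..L} (\<lambda>l. (norm (gradient u (\<gamma> l)))\<^sup>2)"
  proof (rule has_integral_le[OF lower J])
    fix l
    define x y where "x = Re (gradient u (\<gamma> l))" and "y = Im (gradient u (\<gamma> l))"
    \<comment> \<open>Here \<open>x + y\<close> is \<open>D l\<close>; the square of
      \<open>x - y\<close> accounts for the gap between \<open>(x + y)\<^sup>2\<close> and
      \<open>2 * (x\<^sup>2 + y\<^sup>2)\<close>.\<close>
    have "0 \<le> (x + y + c)\<^sup>2 + (x - y)\<^sup>2" by simp
    then have "- c * (x + y) - c\<^sup>2 / 2 \<le> x\<^sup>2 + y\<^sup>2"
      by (simp add: power2_eq_square algebra_simps)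
    then show "- c * D l - c\<^sup>2 / 2 \<le> (norm (gradient u (\<gamma> l)))\<^sup>2"
      by (simp add: D_def x_def y_def cmod_power2 inner_complex_def)
  qed
  moreover have "c / 2 \<le> - c * (u (\<gamma> L) - u (\<gamma> 0)) - L *\<^sub>R (c\<^sup>2 / 2)"
  proof -
    have "\<gamma> 0 = of_real t" by (simp add: \<gamma>_def complex_eq_iff)
    then have "c \<le> c * u (\<gamma> 0)" using ut c by simp
    moreover have "L * c\<^sup>2 \<le> (1 - t) * c\<^sup>2" using L(2) by (intro mult_right_mono) auto
    moreover have "(1 - t) * c\<^sup>2 = c" using c by (simp add: c_def power2_eq_square)
    ultimately show ?thesis using uL by simp
  qed
  ultimately have "c / 2 \<le> integral {0..L} (\<lambda>l. (norm (gradient u (\<gamma> l)))\<^sup>2)"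
    by (rule order_trans[rotated])
  moreover have "1 / (2 * (1 - t)) = c / 2"
    by (simp add: c_def)
  ultimately have "ennreal (1 / (2 * (1 - t))) \<le>
      ennreal (integral {0..L} (\<lambda>l. (norm (gradient u (\<gamma> l)))\<^sup>2))"
    by (metis ennreal_leI)
  also have "\<dots> = (\<integral>\<^sup>+l. ennreal ((norm (gradient u (\<gamma> l)))\<^sup>2) * indicator {0..L} l \<partial>lborel)"
    using J by (intro nn_integral_has_integral_lebesgue'[symmetric]) auto
  also have "\<dots> \<le> (\<integral>\<^sup>+l. ennreal ((norm (gradient u (\<gamma> l)))\<^sup>2) *
      indicator (ball 0 1) (\<gamma> l) \<partial>lborel)"
    using ball by (intro nn_integral_mono) (auto simp: indicator_def)
  finally show ?thesis by (simp add: \<gamma>_def)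
qed

text \<open>Integrate the energy bounds of the diagonals over their starting points in
  \<open>[0, r]\<close>; the integral of \<open>1 / (2 * (1 - t))\<close> gives the
  logarithm.\<close>

lemma capacity_radius_ge:
  assumes r: "0 < r" "r < 1"
  shows "ennreal (ln (1 / (1 - r)) / 2) \<le> capacity (ball 0 1) (closed_segment 0 (of_real r))"
  unfolding capacity_def
proof (rule INF_greatest, clarify)
  fix u :: "complex \<Rightarrow> real"
  assume u: "smooth_compact_support_on (ball 0 1) u"
    and ge1: "\<forall>z\<in>closed_segment 0 (of_real r). 1 \<le> u z"
  define f where "f z = ennreal ((norm (gradient u z))\<^sup>2) * indicator (ball 0 1) z" for z
  have C1: "Ck_on 1 u (ball 0 1)"
    using u unfolding smooth_compact_support_on_def by blast
  \<comment> \<open>The gradient is controlled only on the disk, so measurability is shown after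
    cutting off by the indicator.\<close>
  have "(\<lambda>z. indicator (ball 0 1) z *\<^sub>R (norm (gradient u z))\<^sup>2) \<in> borel_measurable borel"
    by (intro borel_measurable_continuous_on_indicator continuous_intros
        continuous_on_gradient[OF C1]) auto
  then have "(\<lambda>z. ennreal (indicator (ball 0 1) z *\<^sub>R (norm (gradient u z))\<^sup>2)) \<in> borel_measurable borel"
    by measurable
  also have "(\<lambda>z. ennreal (indicator (ball 0 1) z *\<^sub>R (norm (gradient u z))\<^sup>2)) = f"
    by (auto simp: f_def indicator_def)
  finally have f: "f \<in> borel_measurable borel" .
  have "((\<lambda>t. 1 / (2 * (1 - t))) has_integral - ln (1 - r) / 2 - - ln (1 - 0) / 2) {0..r}"
    using r by (intro fundamental_theorem_of_calculus)
      (auto simp: has_real_derivative_iff_has_vector_derivative[symmetric] field_simps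
        intro!: derivative_eq_intros)
  then have "ennreal (ln (1 / (1 - r)) / 2) =
      (\<integral>\<^sup>+t. ennreal (1 / (2 * (1 - t))) * indicator {0..r} t \<partial>lborel)"
    using r by (subst nn_integral_has_integral_lebesgue') (auto simp: ln_div)
  also have "\<dots> \<le> (\<integral>\<^sup>+t. \<integral>\<^sup>+l. f (Complex (t + l) l) \<partial>lborel \<partial>lborel)"
  proof (rule nn_integral_mono)
    fix t :: real
    have "ennreal (1 / (2 * (1 - t))) \<le> (\<integral>\<^sup>+l. f (Complex (t + l) l) \<partial>lborel)" if "t \<in> {0..r}"
    proof -
      have "of_real t \<in> closed_segment 0 (complex_of_real r)"
        using that r by (auto simp: in_segment scaleR_conv_of_real intro!: exI[of _ "t / r"])
      then show ?thesis
        unfolding f_def using that r ge1 by (intro diagonal_energy u) auto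
    qed
    then show "ennreal (1 / (2 * (1 - t))) * indicator {0..r} t \<le>
        (\<integral>\<^sup>+l. f (Complex (t + l) l) \<partial>lborel)"
      by (auto simp: indicator_def)
  qed
  also have "\<dots> = (\<integral>\<^sup>+z. f z \<partial>lborel)"
    by (rule nn_integral_complex_diagonal[OF f, symmetric])
  finally show "ennreal (ln (1 / (1 - r)) / 2) \<le>
      (\<integral>\<^sup>+z\<in>ball 0 1. ennreal ((norm (gradient u z))\<^sup>2) \<partial>lborel)"
    by (simp add: f_def)
qed


section \<open>Comparison of the star and the radius\<close>

theorem lemma4p6:
  shows "\<exists>(m::nat) (s::real) (r::real). 3 \<le> m \<and> 0 < s \<and> s < 1 \<and> 0 < r \<and> r < 1 \<and>
    hyperbolic_perimeter (closed_segment 0 (of_real r)) = hyperbolic_perimeter (star m s) \<and>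
    capacity (ball 0 1) (closed_segment 0 (of_real r)) \<ge> capacity (ball 0 1) (star m s)"
proof -
  obtain C :: real where C: "\<And>E. E \<subseteq> cball 0 (1/2) \<Longrightarrow> capacity (ball 0 1) E \<le> ennreal C"
    using capacity_small_disk_finite by blast
  \<comment> \<open>At \<open>s = 1/2\<close> equality of perimeters reads
    \<open>ln ((1 + r) / (1 - r)) = real m * ln 3\<close>. Using \<open>1 + r \<le> 2\<close> costs
    \<open>ln 2\<close>, and halving the remaining logarithm turns \<open>C\<close> into
    \<open>2 * C\<close>.\<close>
  obtain n :: nat where n: "2 * C + ln 2 < real n * ln 3"
    using reals_Archimedean3[of "ln 3 :: real"] by auto
  define m where "m = max 3 n"
  have "real n * ln 3 \<le> real m * ln 3"
    by (intro mult_right_mono) (auto simp: m_def)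
  with n have m: "3 \<le> m" "2 * C + ln 2 \<le> real m * ln 3"
    by (simp add: m_def, linarith)
  obtain r where r: "0 < r" "r < 1"
    and per: "hyperbolic_perimeter (closed_segment 0 (of_real r)) = hyperbolic_perimeter (star m (1/2))"
    using ex1_radius_perimeter_star[of m "1/2"] m(1) by auto
  have "ln ((1 + r) / (1 - r)) = real m * ln 3"
    using per m(1) r by (simp add: hyperbolic_perimeter_radius hyperbolic_perimeter_star artanh_def)
  moreover have "ln ((1 + r) / (1 - r)) \<le> ln 2 + ln (1 / (1 - r))"
    using r by (simp add: ln_div)
  ultimately have "C \<le> ln (1 / (1 - r)) / 2"
    using m(2) by linarith
  moreover have "star m (1/2) \<subseteq> cball 0 (1/2)"
    unfolding star_def by (intro UN_least closed_segment_subset) (auto simp: norm_mult)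
  ultimately have "capacity (ball 0 1) (star m (1/2)) \<le> capacity (ball 0 1) (closed_segment 0 (of_real r))"
    using C capacity_radius_ge[OF r] by (meson ennreal_leI order_trans)
  with m(1) r per show ?thesis
    by (intro exI[of _ m] exI[of _ "1/2"] exI[of _ r]) simp
qed

end
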